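(* Let $G$ be a graph on $n$ vertices of diameter at most $4$. Then $c(G)<n^{\frac{3}{5}+o(1)}$, where $o(1)$ denotes a quantity tending to $0$ as $n\to\infty$.
   Context: Cops and Robbers on a graph $G$: first each of $k$ cops chooses an initial vertex, then the robber chooses an initial vertex. Then the players alternate, starting with the cops: in a cops' turn every cop either stays at its vertex or moves to an adjacent vertex, and in the robber's turn the robber stays or moves to an adjacent vertex. Several cops may occupy the same vertex, and both players have full information. The cops win if, whatever the robber does, after some cops' move some cop occupies the robber's vertex. The cop number $c(G)$ is the least $k$ for which the cops win. *)

theory Defs
  imports Complex_Main "Graph_Theory.Graph_Theory"
begin

text \<open>
  Graphs are those of the locale \<open>graph\<close>: finite, without loops or parallel arcs, every edge being
  represented by two opposite arcs. With unit arc costs \<open>wf_digraph.\<mu>\<close> is the usual distance; it is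
  infinite between different components, so a graph of finite diameter is connected.
\<close>

definition graph_diameter :: "('a, 'b) pre_digraph \<Rightarrow> ereal" where
  "graph_diameter G = (SUP u \<in> verts G. SUP v \<in> verts G. wf_digraph.\<mu> G (\<lambda>_. 1) u v)"

definition game_step :: "('a, 'b) pre_digraph \<Rightarrow> 'a \<Rightarrow> 'a \<Rightarrow> bool" where
  "game_step G u v \<longleftrightarrow> u = v \<or> u \<rightarrow>\<^bsub>G\<^esub> v"

definition robber_play :: "('a, 'b) pre_digraph \<Rightarrow> (nat \<Rightarrow> 'a) \<Rightarrow> bool" where
  "robber_play G r \<longleftrightarrow> r 0 \<in> verts G \<and> (\<forall>t. game_step G (r t) (r (Suc t)))"

text \<open>
  A strategy \<open>\<sigma>\<close> maps the list of the robber's positions so far to the positions \<open>\<sigma> h i\<close> of the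
  cops \<open>i < k\<close>: \<open>\<sigma> []\<close> is the initial placement, and \<open>\<sigma> [r 0, \<dots>, r t]\<close> the placement after the
  cops' move number \<open>t + 1\<close>, which answers the robber's position \<open>r t\<close>. As the cops' earlier
  positions are determined by \<open>\<sigma>\<close> and the robber's earlier positions, this is full information.
\<close>

definition cop_strategy ::
    "('a, 'b) pre_digraph \<Rightarrow> nat \<Rightarrow> ('a list \<Rightarrow> nat \<Rightarrow> 'a) \<Rightarrow> bool" where
  "cop_strategy G k \<sigma> \<longleftrightarrow>
     (\<forall>i<k. \<sigma> [] i \<in> verts G) \<and>
     (\<forall>r. robber_play G r \<longrightarrow>
        (\<forall>t. \<forall>i<k. game_step G (\<sigma> (map r [0..<t]) i) (\<sigma> (map r [0..<Suc t]) i)))"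

definition cops_win :: "('a, 'b) pre_digraph \<Rightarrow> nat \<Rightarrow> bool" where
  "cops_win G k \<longleftrightarrow>
     (\<exists>\<sigma>. cop_strategy G k \<sigma> \<and>
        (\<forall>r. robber_play G r \<longrightarrow> (\<exists>t. \<exists>i<k. \<sigma> (map r [0..<Suc t]) i = r t)))"

definition cop_number :: "('a, 'b) pre_digraph \<Rightarrow> nat" where
  "cop_number G = (LEAST k. cops_win G k)"

lemma cops_win_card_verts:
  assumes "finite (verts G)"
  shows "cops_win G (card (verts G))"
proof -
  obtain f where f: "bij_betw f {0..<card (verts G)} (verts G)"
    using ex_bij_betw_nat_finite[OF assms] by blast
  have "cop_strategy G (card (verts G)) (\<lambda>_. f)"
    using bij_betwE[OF f] by (simp add: cop_strategy_def game_step_def)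
  moreover have "\<exists>t. \<exists>i<card (verts G). f i = r t" if "robber_play G r" for r
  proof -
    have "r 0 \<in> f ` {0..<card (verts G)}"
      using that f by (simp add: robber_play_def bij_betw_def)
    then obtain i where "i < card (verts G)" "f i = r 0" by auto
    then show ?thesis by blast
  qed
  ultimately show ?thesis unfolding cops_win_def by blast
qed

lemma cops_win_cop_number:
  assumes "finite (verts G)"
  shows "cops_win G (cop_number G)"
  unfolding cop_number_def using cops_win_card_verts[OF assms] by (rule LeastI)

end

theory Submission
  imports Defs "HOL-Real_Asymp.Real_Asymp"
begin

text \<open>
  Let \<open>K\<close> be \<open>n\<^sup>2\<^sup>/\<^sup>5\<close> up to logarithmic factors. A list \<open>C\<close> of about \<open>n / K\<close> vertices can be chosen so that,
  by Hall's theorem, cops standing on \<open>C\<close> can within \<open>d\<close> moves occupy any set \<open>A\<close>, apart from a subset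
  whose ball of radius \<open>d\<close> is less than \<open>K\<close> times as large as the subset itself. Since the diameter is
  at most 4, every set of at most \<open>n / K\<close> vertices can be occupied within 4 moves. Copies of \<open>C\<close> that
  wait for different moments of the game are independent of each other.

  Suppose that the robber, now at \<open>v\<close>, must step into \<open>F \<subseteq> N[v]\<close>. A copy of \<open>C\<close> sent to \<open>F\<close> forces the step
  to lead into some \<open>X \<subseteq> F\<close> with \<open>|B(X, 2)| < K |X|\<close>.
  If \<open>|N[v]| \<le> n / K\<^sup>2\<close> (with \<open>F = N[v]\<close>), then \<open>B(X, 2)\<close> has at most \<open>n / K\<close> vertices and the robber is
  caught; so all degrees on the robber's route exceed \<open>n / K\<^sup>2\<close>, which is about \<open>n\<^sup>1\<^sup>/\<^sup>5\<close>.
  Otherwise pick greedily at most \<open>2 K\<close> vertices \<open>P\<close> of \<open>N[X]\<close>, each dominating at least \<open>|F| / 2\<close> new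
  vertices of \<open>B(X, 2)\<close>. Cops sent to \<open>P\<close> leave only a part \<open>Q\<close> unoccupied with \<open>|B(Q, 3)| \<le> 2 K\<^sup>2\<close>, and
  the vertices of \<open>B(Q, 2)\<close> of the relevant degrees are dominated by at most \<open>n / K\<close> vertices, which can
  be occupied in time. So the third step avoids \<open>N[P]\<close>, and by the choice of \<open>P\<close> the robber, after two
  steps, has fewer than \<open>|F| / 2\<close> admissible continuations. This cannot be repeated more than
  \<open>log\<^sub>2 n\<close> times.
\<close>

section \<open>Marriages and hitting sets\<close>

text \<open>Induction on \<open>card I\<close>. If a proper nonempty \<open>J\<close> is tight,
  \<open>J\<close> and \<open>I - J\<close> are matched separately, the latter outside the union
  over \<open>J\<close>. Otherwise every proper nonempty subfamily has an element to spare, so any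
  \<open>x\<close> from any \<open>f i\<close> may be used up.\<close>

lemma hall_marriage:
  fixes f :: "'i \<Rightarrow> 'b set"
  assumes "finite I" and "\<And>i. i \<in> I \<Longrightarrow> finite (f i)"
    and "\<And>J. J \<subseteq> I \<Longrightarrow> card J \<le> card (\<Union>(f ` J))"
  shows "\<exists>g. inj_on g I \<and> (\<forall>i\<in>I. g i \<in> f i)"
  using assms
proof (induction "card I" arbitrary: I f rule: less_induct)
  case less
  show ?case
  proof (cases "\<exists>J. J \<subseteq> I \<and> J \<noteq> {} \<and> J \<noteq> I \<and> card (\<Union>(f ` J)) = card J")
    case True
    then obtain J where J: "J \<subseteq> I" "J \<noteq> {}" "J \<noteq> I" "card (\<Union>(f ` J)) = card J"
      by blast
    let ?U = "\<Union>(f ` J)"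
    let ?f = "\<lambda>i. f i - ?U"
    have finJ: "finite J" and finU: "finite ?U"
      using J(1) less.prems finite_subset by blast+
    have "card J < card I"
      using J less.prems(1) by (intro psubset_card_mono) auto
    then have "\<exists>g. inj_on g J \<and> (\<forall>i\<in>J. g i \<in> f i)"
      using finJ J(1) by (intro less.hyps less.prems) auto
    then obtain g where g: "inj_on g J" "\<forall>i\<in>J. g i \<in> f i" by blast
    have "card (I - J) < card I"
      using J less.prems(1) by (intro psubset_card_mono) auto
    moreover have "card L \<le> card (\<Union>(?f ` L))" if "L \<subseteq> I - J" for L
    proof -
      have finL: "finite L" using that less.prems(1) finite_subset by blast
      have "card L + card J = card (L \<union> J)"
        using that finL finJ by (intro card_Un_disjoint[symmetric]) auto
      also have "\<dots> \<le> card (\<Union>(f ` (L \<union> J)))"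
        using that J(1) by (intro less.prems(3)) auto
      also have "\<Union>(f ` (L \<union> J)) = \<Union>(?f ` L) \<union> ?U" by auto
      also have "card \<dots> \<le> card (\<Union>(?f ` L)) + card ?U" by (rule card_Un_le)
      finally show ?thesis using J(4) by simp
    qed
    ultimately obtain h where h: "inj_on h (I - J)" "\<forall>i\<in>I - J. h i \<in> ?f i"
      using less.hyps[of "I - J" ?f] less.prems(1,2) by auto
    let ?g = "\<lambda>i. if i \<in> J then g i else h i"
    have "inj_on ?g I"
    proof (rule inj_onI)
      fix x y assume xy: "x \<in> I" "y \<in> I" "?g x = ?g y"
      have "g a \<noteq> h b \<and> h b \<noteq> g a" if "a \<in> J" "b \<in> I" "b \<notin> J" for a b
      proof -
        have "g a \<in> ?U" using that(1) g(2) by blast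
        moreover have "h b \<notin> ?U" using that(2,3) h(2) by blast
        ultimately show ?thesis by metis
      qed
      then show "x = y"
        using xy g(1) h(1) by (auto split: if_splits simp: inj_on_def)
    qed
    then show ?thesis using g(2) h(2) J(1) by (intro exI[of _ ?g]) auto
  next
    case no_tight: False
    show ?thesis
    proof (cases "I = {}")
      case False
      then obtain i where i: "i \<in> I" by blast
      have "card {i} \<le> card (\<Union>(f ` {i}))" using i by (intro less.prems(3)) auto
      then have "f i \<noteq> {}" by auto
      then obtain x where x: "x \<in> f i" by blast
      let ?f = "\<lambda>k. f k - {x}"
      have "card L \<le> card (\<Union>(?f ` L))" if L: "L \<subseteq> I - {i}" for L
      proof (cases "L = {}")
        case False
        have "card L \<le> card (\<Union>(f ` L))" using L by (intro less.prems(3)) auto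
        moreover have "card L \<noteq> card (\<Union>(f ` L))"
        proof -
          have "L \<subseteq> I" "L \<noteq> I" using L i by auto
          then show ?thesis using no_tight False by metis
        qed
        ultimately have "card L < card (\<Union>(f ` L))" by simp
        moreover have "\<Union>(?f ` L) = \<Union>(f ` L) - {x}" by auto
        moreover have "card (\<Union>(f ` L)) - card {x} \<le> card (\<Union>(f ` L) - {x})"
          by (rule diff_card_le_card_Diff) simp
        ultimately show ?thesis by simp
      qed auto
      moreover have "card (I - {i}) < card I"
        using i less.prems(1) by (intro psubset_card_mono) auto
      ultimately obtain h where h: "inj_on h (I - {i})" "\<forall>k\<in>I - {i}. h k \<in> ?f k"
        using less.hyps[of "I - {i}" ?f] less.prems(1,2) by auto
      have "inj_on (h(i := x)) I"
        using h by (auto simp: inj_on_def)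
      then show ?thesis using h(2) x by (intro exI[of _ "h(i := x)"]) auto
    qed auto
  qed
qed

text \<open>
  The method of conditional expectations: drawing the entries of \<open>xs\<close> uniformly from \<open>X\<close>, the
  right-hand side is the expectation of the left-hand side.
\<close>

lemma ex_list_potential_le:
  fixes w :: "'i \<Rightarrow> real" and z :: real
  assumes "finite I" "finite X" "X \<noteq> {}" and B: "\<And>i. i \<in> I \<Longrightarrow> B i \<subseteq> X"
    and "\<And>i. i \<in> I \<Longrightarrow> 0 \<le> w i" "0 \<le> z" "z \<le> 1"
  shows "\<exists>xs. length xs = m \<and> set xs \<subseteq> X \<and>
    (\<Sum>i\<in>I. w i * z ^ length (filter (\<lambda>x. x \<in> B i) xs))
      \<le> (\<Sum>i\<in>I. w i * (1 - (1 - z) * (card (B i) / card X)) ^ m)"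
  using assms(5)
proof (induction m arbitrary: w)
  case 0
  then show ?case by simp
next
  case (Suc m)
  let ?q = "\<lambda>i. 1 - (1 - z) * (card (B i) / card X)"
  have cX: "card X > 0" using assms(2,3) by (simp add: card_gt_0_iff)
  have q0: "0 \<le> ?q i" if "i \<in> I" for i
  proof -
    have "card (B i) / card X \<le> 1"
      using B[OF that] assms(2) cX by (simp add: card_mono)
    then have "(1 - z) * (card (B i) / card X) \<le> 1 * 1"
      using assms(6,7) by (intro mult_mono) auto
    then show ?thesis by simp
  qed
  \<comment> \<open>The mean factor contributed by the new entry is moved into the weights.\<close>
  obtain xs where xs: "length xs = m" "set xs \<subseteq> X"
    and le: "(\<Sum>i\<in>I. (w i * ?q i) * z ^ length (filter (\<lambda>x. x \<in> B i) xs))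
      \<le> (\<Sum>i\<in>I. (w i * ?q i) * ?q i ^ m)"
    using Suc.IH[of "\<lambda>i. w i * ?q i"] q0 Suc.prems by auto
  let ?c = "\<lambda>i. w i * z ^ length (filter (\<lambda>x. x \<in> B i) xs)"
  let ?h = "\<lambda>x. \<Sum>i\<in>I. ?c i * (if x \<in> B i then z else 1)"
  have step: "(\<Sum>x\<in>X. if x \<in> B i then z else 1) = card X * ?q i" if "i \<in> I" for i
  proof -
    have "(\<Sum>x\<in>X. if x \<in> B i then z else 1) = (\<Sum>x\<in>X. 1 - (1 - z) * (if x \<in> B i then 1 else 0))"
      by (intro sum.cong) auto
    also have "\<dots> = card X - (1 - z) * (\<Sum>x\<in>X. if x \<in> B i then 1 else 0)"
      by (simp add: sum_subtractf flip: sum_distrib_left)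
    also have "(\<Sum>x\<in>X. if x \<in> B i then 1 else 0) = real (card (X \<inter> B i))"
      using assms(2) by (simp add: sum.If_cases)
    also have "X \<inter> B i = B i" using B[OF that] by blast
    finally show ?thesis using cX by (simp add: right_diff_distrib)
  qed
  have "(\<Sum>x\<in>X. ?h x) = (\<Sum>i\<in>I. ?c i * (\<Sum>x\<in>X. if x \<in> B i then z else 1))"
    by (subst sum.swap) (simp add: sum_distrib_left)
  also have "\<dots> = (\<Sum>i\<in>I. ?c i * (card X * ?q i))" using step by (intro sum.cong) auto
  also have "\<dots> = card X * (\<Sum>i\<in>I. ?c i * ?q i)"
    by (simp only: sum_distrib_left) (intro sum.cong, auto simp: mult_ac)
  finally have total: "(\<Sum>x\<in>X. ?h x) = card X * (\<Sum>i\<in>I. ?c i * ?q i)" .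
  \<comment> \<open>Some \<open>x\<close> does no worse than the average of \<open>?h\<close> over
    \<open>X\<close>.\<close>
  have "\<exists>x\<in>X. ?h x \<le> (\<Sum>i\<in>I. ?c i * ?q i)"
  proof (rule ccontr)
    assume "\<not> ?thesis"
    then have "(\<Sum>i\<in>I. ?c i * ?q i) < ?h x" if "x \<in> X" for x
      using that by (meson not_le)
    then have "(\<Sum>x\<in>X. (\<Sum>i\<in>I. ?c i * ?q i)) < (\<Sum>x\<in>X. ?h x)"
      by (rule sum_strict_mono[OF assms(2,3)])
    then show False using total by simp
  qed
  then obtain x where x: "x \<in> X" "?h x \<le> (\<Sum>i\<in>I. ?c i * ?q i)" by blast
  have "(\<Sum>i\<in>I. w i * z ^ length (filter (\<lambda>y. y \<in> B i) (x # xs))) = ?h x"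
    by (intro sum.cong) auto
  also have "\<dots> \<le> (\<Sum>i\<in>I. w i * ?q i ^ Suc m)"
    using x(2) le by (simp add: mult_ac)
  finally show ?case using xs x(1) by (intro exI[of _ "x # xs"]) auto
qed

text \<open>With \<open>z = 0\<close> and unit weights the potential counts the members of
  \<open>\<B>\<close> missed by \<open>xs\<close>, because \<open>0 ^ 0 = 1\<close>; a value below 1
  means that none is missed.\<close>

lemma ex_hitting_list:
  fixes b :: real
  assumes "finite X" "finite \<B>" and B: "\<And>B. B \<in> \<B> \<Longrightarrow> B \<subseteq> X" "\<And>B. B \<in> \<B> \<Longrightarrow> b \<le> card B"
    and "real (card \<B>) * exp (- (l * b / card X)) < 1" and "0 < b"
  shows "\<exists>xs. length xs \<le> l \<and> set xs \<subseteq> X \<and> (\<forall>B\<in>\<B>. B \<inter> set xs \<noteq> {})"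
proof (cases "\<B> = {}")
  case True
  then show ?thesis by (intro exI[of _ "[]"]) auto
next
  case False
  then have "X \<noteq> {}" using B \<open>0 < b\<close> by fastforce
  then have cX: "card X > 0" using assms(1) by (simp add: card_gt_0_iff)
  obtain xs where xs: "length xs = l" "set xs \<subseteq> X"
    and le: "(\<Sum>B\<in>\<B>. 1 * (0::real) ^ length (filter (\<lambda>x. x \<in> B) xs))
      \<le> (\<Sum>B\<in>\<B>. 1 * (1 - (1 - 0) * (card B / card X)) ^ l)"
    using ex_list_potential_le[OF assms(2) assms(1) \<open>X \<noteq> {}\<close>, where B = "\<lambda>B. B" and w = "\<lambda>_. 1" and z = 0 and m = l] B(1)
    by auto
  have "(1 - card B / card X) ^ l \<le> exp (- (l * b / card X))" if "B \<in> \<B>" for B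
  proof -
    have "card B \<le> card X" using that B(1) assms(1) by (simp add: card_mono)
    then have "(1 - card B / card X) ^ l \<le> exp (- (card B / card X)) ^ l"
      using cX exp_ge_add_one_self[of "- (card B / card X)"] by (intro power_mono) auto
    also have "\<dots> = exp (- (l * card B / card X))"
      by (simp flip: exp_of_nat_mult)
    also have "\<dots> \<le> exp (- (l * b / card X))"
      using B(2)[OF that] cX by (simp add: divide_right_mono mult_left_mono)
    finally show ?thesis .
  qed
  then have "(\<Sum>B\<in>\<B>. (1 - card B / card X) ^ l) \<le> (\<Sum>B\<in>\<B>. exp (- (l * b / card X)))"
    by (intro sum_mono) auto
  then have lt1: "(\<Sum>B\<in>\<B>. (0::real) ^ length (filter (\<lambda>x. x \<in> B) xs)) < 1"
    using le assms(5) by simp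
  have "B \<inter> set xs \<noteq> {}" if "B \<in> \<B>" for B
  proof
    assume "B \<inter> set xs = {}"
    then have "filter (\<lambda>x. x \<in> B) xs = []" by (auto simp: filter_empty_conv)
    moreover have "(0::real) ^ length (filter (\<lambda>x. x \<in> B) xs)
        \<le> (\<Sum>B\<in>\<B>. (0::real) ^ length (filter (\<lambda>x. x \<in> B) xs))"
      using that assms(2) by (intro member_le_sum) auto
    ultimately show False using lt1 by simp
  qed
  then show ?thesis using xs by auto
qed

lemma sum_power_card_Pow:
  fixes c :: "'c :: comm_semiring_1"
  assumes "finite V"
  shows "(\<Sum>A\<in>Pow V. c ^ card A) = (1 + c) ^ card V"
  using assms
proof induction
  case (insert x F)
  have "(\<Sum>A\<in>Pow (insert x F). c ^ card A)
      = (\<Sum>A\<in>Pow F. c ^ card A) + (\<Sum>A\<in>insert x ` Pow F. c ^ card A)"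
    using insert by (subst Pow_insert, intro sum.union_disjoint) auto
  also have "(\<Sum>A\<in>insert x ` Pow F. c ^ card A) = (\<Sum>A\<in>Pow F. c ^ card (insert x A))"
    using insert by (intro sum.reindex_cong[where l = "insert x"]) (auto simp: inj_on_def)
  also have "\<dots> = (\<Sum>A\<in>Pow F. c * c ^ card A)"
  proof (intro sum.cong refl)
    fix A assume "A \<in> Pow F"
    then have "finite A" "x \<notin> A" using insert finite_subset by auto
    then show "c ^ card (insert x A) = c * c ^ card A" by simp
  qed
  finally show ?case using insert by (simp add: sum_distrib_left[symmetric] algebra_simps)
qed simp

section \<open>Coordinated cop strategies\<close>

context graph
begin

lemma game_step_refl [simp]: "game_step G u u"
  by (simp add: game_step_def)

lemma game_step_sym: "game_step G u v \<Longrightarrow> game_step G v u"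
  using sym_arcs by (auto simp: game_step_def dest: arcs_ends_symmetric)

lemma game_step_in_verts: "game_step G u v \<Longrightarrow> u \<in> verts G \<Longrightarrow> v \<in> verts G"
  by (auto simp: game_step_def dest: adj_in_verts)

lemma robber_play_in_verts: "robber_play G r \<Longrightarrow> r t \<in> verts G"
  by (induction t) (auto simp: robber_play_def intro: game_step_in_verts)

section \<open>Closed neighbourhoods and balls\<close>

definition nbhd :: "'a set \<Rightarrow> 'a set" where
  "nbhd A = {v. \<exists>u\<in>A. game_step G u v}"

abbreviation ball :: "nat \<Rightarrow> 'a set \<Rightarrow> 'a set" where
  "ball d A \<equiv> (nbhd ^^ d) A"

lemma nbhdI: "u \<in> A \<Longrightarrow> game_step G u v \<Longrightarrow> v \<in> nbhd A"
  by (auto simp: nbhd_def)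

lemma nbhdE:
  assumes "v \<in> nbhd A"
  obtains u where "u \<in> A" "game_step G u v"
  using assms by (auto simp: nbhd_def)

lemma nbhd_superset: "A \<subseteq> nbhd A"
  unfolding nbhd_def using game_step_refl by blast

lemma nbhd_mono: "A \<subseteq> B \<Longrightarrow> nbhd A \<subseteq> nbhd B"
  by (auto simp: nbhd_def)

lemma nbhd_UN: "nbhd (\<Union>x\<in>A. f x) = (\<Union>x\<in>A. nbhd (f x))"
  by (auto simp: nbhd_def)

lemma ball_UN: "ball d (\<Union>x\<in>A. f x) = (\<Union>x\<in>A. ball d (f x))"
  by (induction d) (simp_all add: nbhd_UN)

lemma ball_eq_UN: "ball d A = (\<Union>x\<in>A. ball d {x})"
  using ball_UN[of d "\<lambda>x. {x}" A] by simp

lemma ball_mono: "A \<subseteq> B \<Longrightarrow> ball d A \<subseteq> ball d B"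
  using ball_eq_UN[of d A] ball_eq_UN[of d B] by auto

lemma ball_Un: "ball d (A \<union> B) = ball d A \<union> ball d B"
  using ball_eq_UN[of d A] ball_eq_UN[of d B] ball_eq_UN[of d "A \<union> B"] by auto

lemma ball_subset_verts: "A \<subseteq> verts G \<Longrightarrow> ball d A \<subseteq> verts G"
  by (induction d) (auto simp: nbhd_def intro: game_step_in_verts)

lemma nbhd_subset_verts: "A \<subseteq> verts G \<Longrightarrow> nbhd A \<subseteq> verts G"
  using ball_subset_verts[of A 1] by simp

lemma ball_empty [simp]: "ball d {} = {}"
  using ball_eq_UN[of d "{}"] by simp

lemma nbhd_empty [simp]: "nbhd {} = {}"
  by (simp add: nbhd_def)

lemma ball_Suc: "ball (Suc d) A = nbhd (ball d A)"
  by simp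

lemma robber_play_nbhd: "robber_play G r \<Longrightarrow> r t \<in> A \<Longrightarrow> r (Suc t) \<in> nbhd A"
  by (auto simp: robber_play_def nbhd_def)

lemma ball_subset_Suc: "ball d A \<subseteq> ball (Suc d) A"
  using nbhd_superset by simp

text \<open>Steps are symmetric, so the walk can run from \<open>c\<close> back to the centre
  \<open>w\<close>.\<close>

lemma ex_walk_of_ball:
  "c \<in> ball d {w} \<Longrightarrow> \<exists>p. p 0 = c \<and> p d = w \<and> (\<forall>j. game_step G (p j) (p (Suc j)))"
proof (induction d arbitrary: c)
  case 0
  then show ?case by (intro exI[of _ "\<lambda>_. w"]) auto
next
  case (Suc d)
  then obtain u where u: "u \<in> ball d {w}" "game_step G u c" by (auto elim: nbhdE)
  then obtain p where p: "p 0 = u" "p d = w" "\<forall>j. game_step G (p j) (p (Suc j))"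
    using Suc.IH by blast
  let ?p = "case_nat c p"
  have "game_step G (?p j) (?p (Suc j))" for j
    using p u(2) game_step_sym by (cases j) auto
  then show ?case using p by (intro exI[of _ ?p]) auto
qed

section \<open>Strategies of single cops and of teams\<close>

definition legal :: "('a list \<Rightarrow> 'a) \<Rightarrow> bool" where
  "legal \<pi> \<longleftrightarrow> \<pi> [] \<in> verts G \<and>
    (\<forall>r. robber_play G r \<longrightarrow> (\<forall>t. game_step G (\<pi> (map r [0..<t])) (\<pi> (map r [0..<Suc t]))))"

text \<open>The walks belong to the indices of \<open>C\<close>, so repeated vertices stand for
  different cops; cops without a target may walk anywhere.\<close>

definition reachable_targets :: "'a list \<Rightarrow> nat \<Rightarrow> 'a set \<Rightarrow> bool" where
  "reachable_targets C d S \<longleftrightarrow>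
    (\<exists>p. (\<forall>i<length C. p i 0 = C ! i \<and> (\<forall>j. game_step G (p i j) (p i (Suc j)))) \<and>
      S \<subseteq> (\<lambda>i. p i d) ` {..<length C})"

text \<open>The cop waits at \<open>c\<close> until the robber's positions up to time
  \<open>s\<close> are known, makes \<open>d\<close> moves along a walk depending only on these, and
  uses the next move to capture the robber at \<open>r (s + d)\<close> if that is one step away.
  Afterwards it rests.\<close>

lemma legal_travel_then_strike:
  fixes s d :: nat and p :: "'a list \<Rightarrow> nat \<Rightarrow> 'a"
  assumes "c \<in> verts G" "1 \<le> d" and p0: "\<And>h. p h 0 = c"
    and p: "\<And>h j. game_step G (p h j) (p h (Suc j))"
  defines "\<pi> \<equiv> \<lambda>h. if length h \<le> s then c
     else let q = p (take (Suc s) h); j = length h - s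
       in if j \<le> d then q j else if game_step G (q d) (h ! (s + d)) then h ! (s + d) else q d"
  shows "legal \<pi>"
  unfolding legal_def
proof (intro conjI allI impI)
  show "\<pi> [] \<in> verts G" using assms(1) by (simp add: \<pi>_def)
next
  fix r t assume "robber_play G r"
  let ?h = "map r [0..<Suc s]"
  have tk: "take (Suc s) (map r [0..<u]) = ?h" if "s < u" for u
    using that by (simp only: take_map take_upt add_0)
  have wait: "\<pi> (map r [0..<u]) = c" if "u \<le> s" for u
    using that by (simp add: \<pi>_def)
  have travel: "\<pi> (map r [0..<u]) = p ?h (u - s)" if "s < u" "u \<le> s + d" for u
  proof -
    have "u - s \<le> d" using that by linarith
    then show ?thesis unfolding \<pi>_def Let_def tk[OF that(1)] using that by simp
  qed
  have strike: "\<pi> (map r [0..<u])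
      = (if game_step G (p ?h d) (r (s + d)) then r (s + d) else p ?h d)" if "s + d < u" for u
  proof -
    have "s < u" "\<not> u - s \<le> d" using that by linarith+
    then show ?thesis unfolding \<pi>_def Let_def tk[OF \<open>s < u\<close>] using that by simp
  qed
  consider "t < s" | "t = s" | "s < t" "t < s + d" | "t = s + d" | "s + d < t" by linarith
  then show "game_step G (\<pi> (map r [0..<t])) (\<pi> (map r [0..<Suc t]))"
  proof cases
    case 1
    then show ?thesis using wait[of t] wait[of "Suc t"] by (metis Suc_leI game_step_refl less_imp_le)
  next
    case 2
    then have "\<pi> (map r [0..<t]) = p ?h 0" "\<pi> (map r [0..<Suc t]) = p ?h (Suc 0)"
      using wait[of t] travel[of "Suc t"] assms(2) p0 by simp_all
    then show ?thesis using p by metis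
  next
    case 3
    then have "\<pi> (map r [0..<t]) = p ?h (t - s)" "\<pi> (map r [0..<Suc t]) = p ?h (Suc (t - s))"
      using travel[of t] travel[of "Suc t"] by (simp_all add: Suc_diff_le)
    then show ?thesis using p by metis
  next
    case 4
    then have "\<pi> (map r [0..<t]) = p ?h d"
      using travel[of t] assms(2) by simp
    then show ?thesis using strike[of "Suc t"] 4 by (metis game_step_refl lessI)
  next
    case 5
    then show ?thesis using strike[of t] strike[of "Suc t"] by (metis game_step_refl less_SucI)
  qed
qed

lemma ex_launch:
  assumes "set C \<subseteq> verts G" "1 \<le> d"
    and reach: "\<And>r. robber_play G r \<Longrightarrow> reachable_targets C d (T (map r [0..<Suc s]))"
  shows "\<exists>ps. length ps = length C \<and> (\<forall>\<pi>\<in>set ps. legal \<pi>) \<and>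
    (\<forall>r. robber_play G r \<longrightarrow> r (s + d) \<in> nbhd (T (map r [0..<Suc s])) \<longrightarrow>
      (\<exists>\<pi>\<in>set ps. \<pi> (map r [0..<Suc (s + d)]) = r (s + d)))"
proof -
  have "\<exists>p. (\<forall>i<length C. p i 0 = C ! i \<and> (\<forall>j. game_step G (p i j) (p i (Suc j)))) \<and>
      (reachable_targets C d (T h) \<longrightarrow> T h \<subseteq> (\<lambda>i. p i d) ` {..<length C})" for h
  proof (cases "reachable_targets C d (T h)")
    case True
    then show ?thesis unfolding reachable_targets_def by blast
  next
    \<comment> \<open>Idle walks as a default keep the strategies legal on histories whose targets
      cannot be reached.\<close>
    case False
    then show ?thesis by (intro exI[of _ "\<lambda>i _. C ! i"]) auto
  qed
  then obtain P where
    P: "\<And>h i. i < length C \<Longrightarrow> P h i 0 = C ! i"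
       "\<And>h i j. i < length C \<Longrightarrow> game_step G (P h i j) (P h i (Suc j))" and
    cover: "\<And>h. reachable_targets C d (T h) \<Longrightarrow> T h \<subseteq> (\<lambda>i. P h i d) ` {..<length C}"
    by metis
  define \<pi> where "\<pi> i = (\<lambda>h. if length h \<le> s then C ! i
     else let q = P (take (Suc s) h) i; j = length h - s
       in if j \<le> d then q j else if game_step G (q d) (h ! (s + d)) then h ! (s + d) else q d)" for i
  have "legal (\<pi> i)" if "i < length C" for i
    unfolding \<pi>_def using that P assms(1,2)
    by (intro legal_travel_then_strike[where p = "\<lambda>h. P h i"]) (auto simp: subset_iff)
  moreover have "\<exists>i<length C. \<pi> i (map r [0..<Suc (s + d)]) = r (s + d)"
    if r: "robber_play G r" "r (s + d) \<in> nbhd (T (map r [0..<Suc s]))" for r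
  proof -
    obtain w where w: "w \<in> T (map r [0..<Suc s])" "game_step G w (r (s + d))"
      using r(2) by (auto simp: nbhd_def)
    then obtain i where i: "i < length C" "P (map r [0..<Suc s]) i d = w"
      using cover[OF reach[OF r(1)]] by blast
    have "take (Suc s) (map r [0..<Suc (s + d)]) = map r [0..<Suc s]"
      by (simp only: take_map take_upt add_0)
    moreover have "map r [0..<Suc (s + d)] ! (s + d) = r (s + d)"
      using nth_map_upt[of "s + d" "Suc (s + d)" 0 r] by simp
    ultimately have "\<pi> i (map r [0..<Suc (s + d)]) = r (s + d)"
      using w(2) i(2) by (simp del: upt_Suc add: \<pi>_def Let_def)
    then show ?thesis using i(1) by blast
  qed
  ultimately show ?thesis
    by (intro exI[of _ "map \<pi> [0..<length C]"]) (force simp del: upt_Suc)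
qed

lemma cops_win_list:
  assumes "\<And>\<pi>. \<pi> \<in> set ps \<Longrightarrow> legal \<pi>"
    and "\<And>r. robber_play G r \<Longrightarrow> \<exists>\<pi>\<in>set ps. \<exists>t. \<pi> (map r [0..<Suc t]) = r t"
  shows "cops_win G (length ps)"
  unfolding cops_win_def
proof (intro exI[of _ "\<lambda>h i. (ps ! i) h"] conjI allI impI)
  show "cop_strategy G (length ps) (\<lambda>h i. (ps ! i) h)"
    using assms(1) unfolding cop_strategy_def legal_def by (simp del: upt_Suc)
next
  fix r assume "robber_play G r"
  then show "\<exists>t. \<exists>i<length ps. (ps ! i) (map r [0..<Suc t]) = r t"
    using assms(2) by (metis in_set_conv_nth)
qed

text \<open>Each launch \<open>(s, d, T)\<close> gets its own copy of \<open>C\<close>, which idles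
  until time \<open>s\<close>. The copies do not interact, so their sizes add up and one successful
  launch suffices.\<close>

lemma cops_win_of_launches:
  fixes Ls :: "(nat \<times> nat \<times> ('a list \<Rightarrow> 'a set)) list"
  assumes "set C \<subseteq> verts G"
    and Ls: "\<And>s d T. (s, d, T) \<in> set Ls \<Longrightarrow> 1 \<le> d"
      "\<And>s d T r. (s, d, T) \<in> set Ls \<Longrightarrow> robber_play G r
        \<Longrightarrow> reachable_targets C d (T (map r [0..<Suc s]))"
    and hit: "\<And>r. robber_play G r
        \<Longrightarrow> \<exists>(s, d, T)\<in>set Ls. r (s + d) \<in> nbhd (T (map r [0..<Suc s]))"
  shows "cops_win G (length Ls * length C)"
proof -
  have "\<exists>ps. length ps = length C \<and> (\<forall>\<pi>\<in>set ps. legal \<pi>) \<and>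
    (\<forall>r. robber_play G r \<longrightarrow> r (s + d) \<in> nbhd (T (map r [0..<Suc s])) \<longrightarrow>
      (\<exists>\<pi>\<in>set ps. \<pi> (map r [0..<Suc (s + d)]) = r (s + d)))" if "(s, d, T) \<in> set Ls" for s d T
    using ex_launch[where T = T and s = s, OF assms(1) Ls(1)[OF that] Ls(2)[OF that]] .
  then have "\<forall>x\<in>set Ls. \<exists>ps. length ps = length C \<and> (\<forall>\<pi>\<in>set ps. legal \<pi>) \<and>
    (case x of (s, d, T) \<Rightarrow> \<forall>r. robber_play G r \<longrightarrow> r (s + d) \<in> nbhd (T (map r [0..<Suc s])) \<longrightarrow>
      (\<exists>\<pi>\<in>set ps. \<pi> (map r [0..<Suc (s + d)]) = r (s + d)))"
    by (simp del: upt_Suc add: split_paired_all)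
  from bchoice[OF this] obtain \<Phi> where
    \<Phi>: "\<And>x. x \<in> set Ls \<Longrightarrow> length (\<Phi> x) = length C"
       "\<And>x \<pi>. x \<in> set Ls \<Longrightarrow> \<pi> \<in> set (\<Phi> x) \<Longrightarrow> legal \<pi>"
       "\<And>s d T r. (s, d, T) \<in> set Ls \<Longrightarrow> robber_play G r
          \<Longrightarrow> r (s + d) \<in> nbhd (T (map r [0..<Suc s]))
          \<Longrightarrow> \<exists>\<pi>\<in>set (\<Phi> (s, d, T)). \<pi> (map r [0..<Suc (s + d)]) = r (s + d)"
    by (fastforce simp del: upt_Suc)
  let ?ps = "concat (map \<Phi> Ls)"
  have "length ?ps = (\<Sum>x\<leftarrow>Ls. length C)"
    using \<Phi>(1) by (simp add: length_concat comp_def cong: map_cong)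
  then have "length ?ps = length Ls * length C" by (simp add: sum_list_triv)
  moreover have "cops_win G (length ?ps)"
  proof (rule cops_win_list)
    show "legal \<pi>" if "\<pi> \<in> set ?ps" for \<pi> using that \<Phi>(2) by auto
  next
    fix r assume r: "robber_play G r"
    obtain s d T where L: "(s, d, T) \<in> set Ls" "r (s + d) \<in> nbhd (T (map r [0..<Suc s]))"
      using hit[OF r] by blast
    then obtain \<pi> where "\<pi> \<in> set (\<Phi> (s, d, T))" "\<pi> (map r [0..<Suc (s + d)]) = r (s + d)"
      using \<Phi>(3)[OF L(1) r L(2)] by blast
    moreover have "set (\<Phi> (s, d, T)) \<subseteq> set ?ps" using L(1) by auto
    ultimately show "\<exists>\<pi>\<in>set ?ps. \<exists>t. \<pi> (map r [0..<Suc t]) = r t" by blast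
  qed
  ultimately show ?thesis by simp
qed

text \<open>\<open>well_spread K C\<close> is what a random list \<open>C\<close> of about \<open>(n / K) log n\<close> vertices satisfies.\<close>

definition well_spread :: "nat \<Rightarrow> 'a list \<Rightarrow> bool" where
  "well_spread K C \<longleftrightarrow> set C \<subseteq> verts G \<and>
    (\<forall>d\<in>{2..4}. \<forall>A\<subseteq>verts G. A \<noteq> {} \<longrightarrow> K * card A \<le> card (ball d A) \<longrightarrow>
      card A \<le> length (filter (\<lambda>x. x \<in> ball d A) C))"

text \<open>
  Hall's condition can only fail because of sets that expand by a factor less than \<open>K\<close>; removing a
  largest such set \<open>X\<close> leaves a set satisfying it.
\<close>

lemma ex_small_expansion_remainder:
  assumes C: "well_spread K C" and d: "d \<in> {2..4}" and A: "A \<subseteq> verts G"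
  shows "\<exists>X\<subseteq>A. (X = {} \<or> card (ball d X) < K * card X) \<and> reachable_targets C d (A - X)"
proof -
  let ?Q = "\<lambda>X. X \<subseteq> A \<and> (X = {} \<or> card (ball d X) < K * card X)"
  have finA: "finite A" using finite_subset[OF A finite_verts] .
  have "\<exists>X. ?Q X \<and> (\<forall>Y. ?Q Y \<longrightarrow> card Y \<le> card X)"
    using finA by (intro ex_has_greatest_nat[of ?Q "{}" card "Suc (card A)"])
      (auto simp: less_Suc_eq_le intro: card_mono)
  then obtain X where X: "?Q X" and max: "\<And>Y. ?Q Y \<Longrightarrow> card Y \<le> card X" by blast
  let ?f = "\<lambda>w. {i. i < length C \<and> C ! i \<in> ball d {w}}"
  have "\<exists>g. inj_on g (A - X) \<and> (\<forall>w\<in>A - X. g w \<in> ?f w)"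
  proof (rule hall_marriage)
    fix J assume J: "J \<subseteq> A - X"
    show "card J \<le> card (\<Union>(?f ` J))"
    proof (cases "J = {}")
      case False
      have finJ: "finite J" "finite X" using J X finA finite_subset by blast+
      have "card (J \<union> X) = card J + card X"
        using J finJ by (intro card_Un_disjoint) auto
      moreover have "card J > 0" using False finJ by (simp add: card_gt_0_iff)
      \<comment> \<open>By maximality \<open>J \<union> X\<close> expands by the factor
        \<open>K\<close>. The ball of \<open>X\<close> has at most \<open>K * card X\<close>
        vertices, so \<open>J\<close> expands too, and \<open>well_spread\<close> gives Hall's
        condition for it.\<close>
      ultimately have "\<not> ?Q (J \<union> X)" using max[of "J \<union> X"] by linarith
      then have "K * card (J \<union> X) \<le> card (ball d (J \<union> X))" using J X False by auto
      also have "\<dots> \<le> card (ball d J) + card (ball d X)"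
        unfolding ball_Un by (rule card_Un_le)
      finally have "K * card J \<le> card (ball d J)"
        using X \<open>card (J \<union> X) = card J + card X\<close> by (auto simp: algebra_simps)
      then have "card J \<le> length (filter (\<lambda>x. x \<in> ball d J) C)"
        using C d J A False unfolding well_spread_def by blast
      also have "\<dots> = card {i. i < length C \<and> C ! i \<in> ball d J}"
        by (rule length_filter_conv_card)
      also have "{i. i < length C \<and> C ! i \<in> ball d J} = \<Union>(?f ` J)"
        using ball_eq_UN[of d J] by auto
      finally show ?thesis .
    qed simp
  qed (use finA in auto)
  then obtain g where g: "inj_on g (A - X)" "\<And>w. w \<in> A - X \<Longrightarrow> g w \<in> ?f w" by blast
  have "\<exists>p. p 0 = C ! i \<and> (\<forall>j. game_step G (p j) (p (Suc j))) \<and>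
      (\<forall>w\<in>A - X. g w = i \<longrightarrow> p d = w)" for i
  proof (cases "\<exists>w\<in>A - X. g w = i")
    case True
    then obtain w where w: "w \<in> A - X" "g w = i" by blast
    then have "C ! i \<in> ball d {w}" using g(2) by auto
    then obtain p where "p 0 = C ! i" "p d = w" "\<forall>j. game_step G (p j) (p (Suc j))"
      using ex_walk_of_ball by blast
    moreover have "w' = w" if "w' \<in> A - X" "g w' = i" for w'
      using that w g(1) by (auto dest: inj_onD)
    ultimately show ?thesis by blast
  next
    case False
    then show ?thesis by (intro exI[of _ "\<lambda>_. C ! i"]) auto
  qed
  then obtain p where p: "\<And>i. p i 0 = C ! i" "\<And>i j. game_step G (p i j) (p i (Suc j))"
    "\<And>i w. w \<in> A - X \<Longrightarrow> g w = i \<Longrightarrow> p i d = w" by metis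
  have "A - X \<subseteq> (\<lambda>i. p i d) ` {..<length C}"
  proof
    fix w assume "w \<in> A - X"
    then have "p (g w) d = w" "g w < length C" using p(3) g(2) by auto
    then show "w \<in> (\<lambda>i. p i d) ` {..<length C}" by force
  qed
  then have "reachable_targets C d (A - X)" unfolding reachable_targets_def using p(1,2) by blast
  then show ?thesis using X by blast
qed

section \<open>Confining the robber\<close>

text \<open>The potential with \<open>z = 1/2\<close> and weight \<open>2 ^ card A\<close>: a pair
  \<open>(d, A)\<close> hit fewer than \<open>card A\<close> times has a term of at least 1, so a
  total below 1 rules out all failures.\<close>

lemma ex_well_spread:
  assumes n: "card (verts G) = n" "0 < n"
    and m: "exp (- (real m * real K / (2 * real n))) \<le> 1 / (16 * real n)"
  shows "\<exists>C. length C = m \<and> well_spread K C"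
proof -
  let ?V = "verts G"
  define I where "I = {(d, A). d \<in> {2..4} \<and> A \<in> Pow ?V - {{}} \<and> K * card A \<le> card (ball d A)}"
  define e where "e = exp (- (real m * real K / (2 * real n)))"
  define B where "B = (\<lambda>(d, A). ball d A)"
  define w :: "nat \<times> 'a set \<Rightarrow> real" where "w = (\<lambda>(d, A). 2 ^ card A)"
  let ?J = "{2..4::nat} \<times> (Pow ?V - {{}})"
  have IJ: "I \<subseteq> ?J" by (auto simp: I_def)
  have finJ: "finite ?J" by simp
  have finI: "finite I" using finite_subset[OF IJ finJ] .
  have ne: "?V \<noteq> {}" using n by auto
  have BV: "B i \<subseteq> ?V" if "i \<in> I" for i
    using that ball_subset_verts by (auto simp: I_def B_def)
  have w0: "0 \<le> w i" for i by (simp add: w_def split: prod.split)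
  obtain C where C: "length C = m" "set C \<subseteq> ?V" and
    le: "(\<Sum>i\<in>I. w i * (1/2) ^ length (filter (\<lambda>x. x \<in> B i) C))
      \<le> (\<Sum>i\<in>I. w i * (1 - (1 - 1/2) * (card (B i) / card ?V)) ^ m)"
    using ex_list_potential_le[OF finI finite_verts ne, of B w "1/2" m] BV w0 by auto
  have term_le: "w i * (1 - (1 - 1/2) * (card (B i) / card ?V)) ^ m \<le> (2 * e) ^ card (snd i)"
    if "i \<in> I" for i
  proof -
    have Kle: "K * card (snd i) \<le> card (B i)" using that by (auto simp: I_def B_def)
    have "card (B i) \<le> n" using BV[OF that] n by (auto intro: card_mono)
    then have "(1 - (1 - 1/2) * (card (B i) / card ?V)) ^ m \<le> exp (- (card (B i) / (2 * n))) ^ m"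
      using n exp_ge_add_one_self[of "- (card (B i) / (2 * n))"]
      by (intro power_mono) (auto simp: field_simps)
    also have "\<dots> = exp (- (real m * card (B i) / (2 * n)))"
      by (simp flip: exp_of_nat_mult)
    also have "\<dots> \<le> exp (- (real m * (K * card (snd i)) / (2 * n)))"
      using n Kle by (simp add: divide_right_mono mult_left_mono flip: of_nat_mult)
    also have "\<dots> = e ^ card (snd i)"
      unfolding e_def by (simp add: field_simps flip: exp_of_nat_mult)
    finally have "(1 - (1 - 1/2) * (card (B i) / card ?V)) ^ m \<le> e ^ card (snd i)" .
    then show ?thesis by (auto simp: w_def power_mult_distrib split: prod.split intro: mult_left_mono)
  qed
  have e0: "0 \<le> e" by (simp add: e_def)
  have "(\<Sum>i\<in>I. w i * (1 - (1 - 1/2) * (card (B i) / card ?V)) ^ m) \<le> (\<Sum>i\<in>I. (2 * e) ^ card (snd i))"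
    using term_le by (rule sum_mono)
  also have "\<dots> \<le> (\<Sum>i\<in>?J. (2 * e) ^ card (snd i))"
    using IJ finJ e0 by (intro sum_mono2) auto
  also have "\<dots> = 3 * (\<Sum>A\<in>Pow ?V - {{}}. (2 * e) ^ card A)"
    by (simp add: sum.cartesian_product')
  also have "(\<Sum>A\<in>Pow ?V - {{}}. (2 * e) ^ card A) = (1 + 2 * e) ^ n - 1"
    using sum_power_card_Pow[OF finite_verts, of "2 * e"] n by (subst sum_diff1) auto
  also have "(1 + 2 * e) ^ n \<le> exp (2 * e) ^ n"
    using e0 by (intro power_mono) auto
  also have "exp (2 * e) ^ n = exp (n * (2 * e))" by (simp flip: exp_of_nat_mult)
  also have "\<dots> \<le> exp (1 / 8)"
    using m n by (simp add: e_def field_simps)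
  \<comment> \<open>The factor 3 counts the radii 2, 3 and 4, so the total is at most
    \<open>3 * (1/8 + 1/64) < 1\<close>.\<close>
  also have "exp (1 / 8 :: real) \<le> 1 + 1 / 8 + (1 / 8)\<^sup>2" by (rule exp_bound) auto
  finally have lt1: "(\<Sum>i\<in>I. w i * (1/2) ^ length (filter (\<lambda>x. x \<in> B i) C)) < 1"
    using le by (simp add: power2_eq_square)
  have "card A \<le> length (filter (\<lambda>x. x \<in> ball d A) C)" if "(d, A) \<in> I" for d A
  proof (rule ccontr)
    let ?c = "length (filter (\<lambda>x. x \<in> ball d A) C)"
    assume "\<not> card A \<le> ?c"
    then have "(2::real) ^ ?c \<le> 2 ^ card A" by (intro power_increasing) auto
    then have "1 \<le> w (d, A) * (1/2) ^ length (filter (\<lambda>x. x \<in> B (d, A)) C)"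
      by (simp add: w_def B_def power_divide field_simps)
    also have "\<dots> \<le> (\<Sum>i\<in>I. w i * (1/2) ^ length (filter (\<lambda>x. x \<in> B i) C))"
      using that finI by (intro member_le_sum) (auto simp: w_def)
    finally show False using lt1 by simp
  qed
  then have "well_spread K C" using C(2) by (auto simp: well_spread_def I_def)
  then show ?thesis using C(1) by blast
qed

text \<open>A largest \<open>P\<close> whose centres cover on average at least \<open>f / 2\<close>
  vertices of \<open>Y\<close> works: a vertex \<open>u\<close> covering \<open>f / 2\<close> new
  ones could still be added.\<close>

lemma ex_greedy_centres:
  assumes "finite U" "finite Y" "0 < f"
  shows "\<exists>P\<subseteq>U. card P * f \<le> 2 * card (Y \<inter> nbhd P) \<and>
    (\<forall>u\<in>U. 2 * card (nbhd {u} \<inter> (Y - nbhd P)) < f)"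
proof -
  let ?Q = "\<lambda>P. P \<subseteq> U \<and> card P * f \<le> 2 * card (Y \<inter> nbhd P)"
  have "\<exists>P. ?Q P \<and> (\<forall>P'. ?Q P' \<longrightarrow> card P' \<le> card P)"
    using assms(1) by (intro ex_has_greatest_nat[of ?Q "{}" card "Suc (card U)"])
      (auto simp: less_Suc_eq_le intro: card_mono)
  then obtain P where P: "?Q P" and max: "\<And>P'. ?Q P' \<Longrightarrow> card P' \<le> card P" by blast
  have finP: "finite P" using P assms(1) finite_subset by blast
  have "2 * card (nbhd {u} \<inter> (Y - nbhd P)) < f" if u: "u \<in> U" for u
  proof (rule ccontr)
    let ?N = "nbhd {u} \<inter> (Y - nbhd P)"
    assume ge: "\<not> 2 * card ?N < f"
    have "u \<notin> P"
    proof
      assume "u \<in> P"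
      then have "?N = {}" using nbhd_mono[of "{u}" P] by auto
      then have "card ?N = 0" by (metis card.empty)
      then show False using ge assms(3) by linarith
    qed
    have "card (Y \<inter> nbhd P) + card ?N = card ((Y \<inter> nbhd P) \<union> ?N)"
      using assms(2) by (intro card_Un_disjoint[symmetric]) auto
    also have "\<dots> \<le> card (Y \<inter> nbhd (insert u P))"
      using assms(2) nbhd_mono[of P "insert u P"] nbhd_mono[of "{u}" "insert u P"]
      by (intro card_mono) auto
    finally have "?Q (insert u P)"
      using P u ge \<open>u \<notin> P\<close> finP by (auto simp: algebra_simps)
    then show False using max[of "insert u P"] \<open>u \<notin> P\<close> finP by simp
  qed
  then show ?thesis using P by blast
qed

text \<open>The neighbourhoods of the vertices \<open>u\<close> in question lie in
  \<open>ball 3 Q\<close> and each fills more than a fraction \<open>n / (2 * K ^ 4)\<close> of it,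
  so \<open>l\<close> vertices can hit them all. By symmetry, hitting \<open>nbhd {u}\<close> means
  dominating \<open>u\<close>.\<close>

lemma ex_dominating_subset:
  assumes n: "card (verts G) = n" "0 < n" and "0 < K" and Q: "Q \<subseteq> verts G"
    and b3: "card (ball 3 Q) \<le> 2 * K ^ 2"
    and l: "real n * exp (- (real l * real n / (2 * real K ^ 4))) < 1"
  shows "\<exists>S\<subseteq>verts G. card S \<le> l \<and>
    (\<forall>u\<in>ball 2 Q. n < card (nbhd {u}) * K ^ 2 \<longrightarrow> u \<in> nbhd S)"
proof (cases "ball 3 Q = {}")
  case True
  then have "ball 2 Q = {}" using ball_subset_Suc[of 2 Q] by (simp add: numeral_3_eq_3 numeral_2_eq_2)
  then show ?thesis by (intro exI[of _ "{}"]) auto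
next
  case False
  let ?X = "ball 3 Q"
  define \<B> where "\<B> = (\<lambda>u. nbhd {u}) ` {u \<in> ball 2 Q. n < card (nbhd {u}) * K ^ 2}"
  have X: "?X \<subseteq> verts G" "finite ?X"
    using ball_subset_verts[OF Q] finite_subset[OF _ finite_verts] by blast+
  have b2: "ball 2 Q \<subseteq> verts G" using ball_subset_verts[OF Q] .
  have fin2: "finite (ball 2 Q)" using finite_subset[OF b2 finite_verts] .
  have "card \<B> \<le> card {u \<in> ball 2 Q. n < card (nbhd {u}) * K ^ 2}"
    unfolding \<B>_def using fin2 by (intro card_image_le) auto
  also have "\<dots> \<le> card (verts G)" using b2 by (intro card_mono) auto
  finally have cB: "card \<B> \<le> n" using n by simp
  let ?b = "real n / real K ^ 2"
  have "real l * real n / (2 * real K ^ 4) \<le> real l * ?b / card ?X"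
  proof -
    have "real (card ?X) \<le> 2 * real K ^ 2" using b3 by (metis of_nat_le_iff of_nat_mult of_nat_numeral of_nat_power)
    moreover have "0 < real (card ?X)" using False X(2) by (simp add: card_gt_0_iff)
    ultimately have "real l * ?b / (2 * real K ^ 2) \<le> real l * ?b / card ?X"
      using \<open>0 < K\<close> by (intro divide_left_mono) auto
    moreover have "real l * ?b / (2 * real K ^ 2) = real l * real n / (2 * real K ^ 4)"
      by (simp add: field_simps eval_nat_numeral)
    ultimately show ?thesis by metis
  qed
  then have "real (card \<B>) * exp (- (real l * ?b / card ?X))
      \<le> real n * exp (- (real l * real n / (2 * real K ^ 4)))"
    using cB by (intro mult_mono) auto
  then have small: "real (card \<B>) * exp (- (real l * ?b / card ?X)) < 1" using l by simp
  have "\<exists>xs. length xs \<le> l \<and> set xs \<subseteq> ?X \<and> (\<forall>B\<in>\<B>. B \<inter> set xs \<noteq> {})"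
  proof (rule ex_hitting_list[OF X(2) _ _ _ small])
    show "finite \<B>" using fin2 by (simp add: \<B>_def)
    show "B \<subseteq> ?X" if B: "B \<in> \<B>" for B
    proof -
      obtain u where "u \<in> ball 2 Q" "B = nbhd {u}" using B by (auto simp: \<B>_def)
      then show ?thesis using nbhd_mono[of "{u}" "ball 2 Q"] ball_Suc[of 2 Q] by simp
    qed
    show "?b \<le> card B" if "B \<in> \<B>" for B
    proof -
      have "n < card B * K ^ 2" using that by (auto simp: \<B>_def)
      then have "real n < real (card B) * real K ^ 2"
        by (metis of_nat_less_iff of_nat_mult of_nat_power)
      then show ?thesis using \<open>0 < K\<close> by (simp add: field_simps)
    qed
    show "0 < ?b" using n \<open>0 < K\<close> by simp
  qed
  then obtain xs where xs: "length xs \<le> l" "set xs \<subseteq> ?X" "\<And>B. B \<in> \<B> \<Longrightarrow> B \<inter> set xs \<noteq> {}" by blast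
  have "u \<in> nbhd (set xs)" if "u \<in> ball 2 Q" "n < card (nbhd {u}) * K ^ 2" for u
  proof -
    have "nbhd {u} \<in> \<B>" using that by (auto simp: \<B>_def)
    then obtain x where "x \<in> nbhd {u}" "x \<in> set xs" using xs(3) by blast
    then show ?thesis by (auto elim!: nbhdE intro: nbhdI game_step_sym)
  qed
  moreover have "card (set xs) \<le> l" using card_length[of xs] xs(1) by linarith
  ultimately show ?thesis using xs(2) X(1) by blast
qed

text \<open>At every time \<open>s < 2 * J + 3\<close> five copies of \<open>C\<close> are launched
  by rules fixed in advance. If the robber escaped them all, the safe set \<open>Fw j r\<close>
  would more than halve every two moves and never become empty, which \<open>n < 2 ^ J\<close>
  excludes.\<close>

lemma cops_win_of_well_spread:
  assumes C: "well_spread K C" and n: "card (verts G) = n" "0 < n" and K: "0 < K"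
    and diam: "\<And>u. u \<in> verts G \<Longrightarrow> verts G \<subseteq> ball 4 {u}"
    and lK: "l * K \<le> n" and l: "real n * exp (- (real l * real n / (2 * real K ^ 4))) < 1"
    and J: "n < 2 ^ J"
  shows "cops_win G (5 * (2 * J + 3) * length C)"
proof -
  let ?V = "verts G"
  \<comment> \<open>The choice functions \<open>bad\<close>, \<open>pick\<close> and
    \<open>dom\<close> turn the existence lemmas into targets that are functions of the
    history.\<close>
  have "\<forall>d A. \<exists>X. d \<in> {2..4} \<longrightarrow> A \<subseteq> ?V \<longrightarrow>
      X \<subseteq> A \<and> (X = {} \<or> card (ball d X) < K * card X) \<and> reachable_targets C d (A - X)"
  proof (intro allI)
    show "\<exists>X. d \<in> {2..4} \<longrightarrow> A \<subseteq> ?V \<longrightarrow>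
        X \<subseteq> A \<and> (X = {} \<or> card (ball d X) < K * card X) \<and> reachable_targets C d (A - X)" for d A
      using ex_small_expansion_remainder[OF C, of d A] by blast
  qed
  then obtain bad where bad: "\<And>d A. d \<in> {2..4} \<Longrightarrow> A \<subseteq> ?V \<Longrightarrow> bad d A \<subseteq> A"
      "\<And>d A. d \<in> {2..4} \<Longrightarrow> A \<subseteq> ?V \<Longrightarrow> bad d A = {} \<or> card (ball d (bad d A)) < K * card (bad d A)"
      "\<And>d A. d \<in> {2..4} \<Longrightarrow> A \<subseteq> ?V \<Longrightarrow> reachable_targets C d (A - bad d A)"
    by metis
  have fin: "finite A" if "A \<subseteq> ?V" for A using finite_subset[OF that finite_verts] .
  \<comment> \<open>A ball of radius 4 around a nonempty set is everything, so a nonempty remainder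
    would need more than \<open>n / K\<close> vertices.\<close>
  have bad4: "bad 4 A = {}" if A: "A \<subseteq> ?V" "K * card A \<le> n" for A
  proof (rule ccontr)
    assume ne: "bad 4 A \<noteq> {}"
    have sub: "bad 4 A \<subseteq> A" using bad(1)[of 4 A] A(1) by auto
    obtain u where "u \<in> bad 4 A" using ne by blast
    then have "?V \<subseteq> ball 4 (bad 4 A)"
      using diam[of u] ball_mono[of "{u}" "bad 4 A" 4] sub A(1) by blast
    then have "n \<le> card (ball 4 (bad 4 A))"
      unfolding n(1)[symmetric] using sub A(1) by (intro card_mono fin ball_subset_verts) auto
    also have "\<dots> < K * card (bad 4 A)" using bad(2)[of 4 A] A(1) ne by simp
    also have "\<dots> \<le> K * card A" using sub fin[OF A(1)] by (simp add: card_mono)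
    finally show False using A(2) by simp
  qed
  have "\<forall>F. \<exists>P. F \<subseteq> ?V \<longrightarrow> F \<noteq> {} \<longrightarrow> P \<subseteq> nbhd (bad 2 F) \<and>
      card P * card F \<le> 2 * card (ball 2 (bad 2 F) \<inter> nbhd P) \<and>
      (\<forall>u\<in>nbhd (bad 2 F). 2 * card (nbhd {u} \<inter> (ball 2 (bad 2 F) - nbhd P)) < card F)"
  proof
    fix F
    show "\<exists>P. F \<subseteq> ?V \<longrightarrow> F \<noteq> {} \<longrightarrow> P \<subseteq> nbhd (bad 2 F) \<and>
      card P * card F \<le> 2 * card (ball 2 (bad 2 F) \<inter> nbhd P) \<and>
      (\<forall>u\<in>nbhd (bad 2 F). 2 * card (nbhd {u} \<inter> (ball 2 (bad 2 F) - nbhd P)) < card F)"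
    proof (cases "F \<subseteq> ?V \<and> F \<noteq> {}")
      case True
      then have "bad 2 F \<subseteq> ?V" "0 < card F"
        using bad(1)[of 2 F] fin[of F] by (auto simp: card_gt_0_iff)
      then show ?thesis
        using ex_greedy_centres[of "nbhd (bad 2 F)" "ball 2 (bad 2 F)" "card F"]
          fin nbhd_subset_verts ball_subset_verts by meson
    qed auto
  qed
  then obtain pick where
    pick: "\<And>F. F \<subseteq> ?V \<Longrightarrow> F \<noteq> {} \<Longrightarrow> pick F \<subseteq> nbhd (bad 2 F)"
      "\<And>F. F \<subseteq> ?V \<Longrightarrow> F \<noteq> {} \<Longrightarrow>
        card (pick F) * card F \<le> 2 * card (ball 2 (bad 2 F) \<inter> nbhd (pick F))"
      "\<And>F u. F \<subseteq> ?V \<Longrightarrow> F \<noteq> {} \<Longrightarrow> u \<in> nbhd (bad 2 F) \<Longrightarrow>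
        2 * card (nbhd {u} \<inter> (ball 2 (bad 2 F) - nbhd (pick F))) < card F"
    by metis
  have "\<forall>Q. \<exists>S. Q \<subseteq> ?V \<longrightarrow> card (ball 3 Q) \<le> 2 * K ^ 2 \<longrightarrow> S \<subseteq> ?V \<and> card S \<le> l \<and>
      (\<forall>u\<in>ball 2 Q. n < card (nbhd {u}) * K ^ 2 \<longrightarrow> u \<in> nbhd S)"
    using ex_dominating_subset[OF n K _ _ l] by meson
  then obtain dom where dom': "\<And>Q. Q \<subseteq> ?V \<longrightarrow> card (ball 3 Q) \<le> 2 * K ^ 2 \<longrightarrow>
      dom Q \<subseteq> ?V \<and> card (dom Q) \<le> l \<and>
      (\<forall>u\<in>ball 2 Q. n < card (nbhd {u}) * K ^ 2 \<longrightarrow> u \<in> nbhd (dom Q))"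
    unfolding choice_iff by blast
  have dom: "dom Q \<subseteq> ?V" "card (dom Q) \<le> l"
      "\<And>u. u \<in> ball 2 Q \<Longrightarrow> n < card (nbhd {u}) * K ^ 2 \<Longrightarrow> u \<in> nbhd (dom Q)"
    if "Q \<subseteq> ?V" "card (ball 3 Q) \<le> 2 * K ^ 2" for Q
    using dom'[of Q] that by auto
  \<comment> \<open>\<open>Fw j r\<close> contains the positions \<open>r (2 j + 1)\<close> that are still safe, given \<open>r 0, \<dots>, r (2 j)\<close>.\<close>
  define W where "W F = ball 2 (bad 2 F) - nbhd (pick F)" for F
  define Fw where "Fw j r = rec_nat (nbhd {r 0}) (\<lambda>i F. nbhd {r (2 * i + 2)} \<inter> W F) j"
    for j and r :: "nat \<Rightarrow> 'a"
  have Fw_0: "Fw 0 r = nbhd {r 0}"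
    and Fw_Suc: "Fw (Suc j) r = nbhd {r (2 * j + 2)} \<inter> W (Fw j r)" for j r
    by (simp_all add: Fw_def)
  have Fw_cong: "Fw j r = Fw j r'" if "\<And>i. i \<le> 2 * j \<Longrightarrow> r i = r' i" for j r r'
    using that by (induction j) (auto simp: Fw_0 Fw_Suc)
  \<comment> \<open>Cops launched at time \<open>s\<close> know enough of the history to compute
    \<open>Fw j r\<close>.\<close>
  have Fw_hist: "Fw j (\<lambda>i. map r [0..<Suc s] ! i) = Fw j r" if "2 * j \<le> s" for j s r
    using that by (intro Fw_cong) (simp del: upt_Suc)
  have Fw_V: "Fw j r \<subseteq> ?V" if "robber_play G r" for j r
    using robber_play_in_verts[OF that] nbhd_subset_verts
    by (cases j) (auto simp: Fw_0 Fw_Suc dest!: nbhd_subset_verts[THEN subsetD, rotated])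
  define aim where "aim d T = (\<lambda>h. (T h \<inter> ?V) - bad d (T h \<inter> ?V))"
    for d and T :: "'a list \<Rightarrow> 'a set"
  define N1 where "N1 s = (\<lambda>h :: 'a list. nbhd {h ! s})" for s
  define F' where "F' s = (\<lambda>h :: 'a list. Fw (s div 2) (\<lambda>i. h ! i))" for s
  \<comment> \<open>The first two launches force a large degree at time \<open>s\<close>. The other
    three serve the stage starting at \<open>s = 2 * j\<close>; their targets matter only later but
    are already determined by the history up to \<open>s\<close>.\<close>
  define launches :: "nat \<Rightarrow> (nat \<times> nat \<times> ('a list \<Rightarrow> 'a set)) list" where "launches s =
    [(s, 2, aim 2 (N1 s)), (s, 4, aim 4 (\<lambda>h. ball 2 (bad 2 (N1 s h)))),
     (s, 2, aim 2 (F' s)), (s, 3, aim 3 (\<lambda>h. pick (F' s h))),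
     (s, 4, aim 4 (\<lambda>h. dom (bad 3 (pick (F' s h)))))]" for s
  \<comment> \<open>Stage \<open>j < J\<close> uses the degree bound at time
    \<open>2 * j + 4\<close>, which is at most \<open>2 * J + 2\<close>.\<close>
  define S where "S = 2 * J + 3"
  define Ls where "Ls = concat (map launches [0..<S])"
  have "length (launches s) = 5" for s by (simp add: launches_def)
  then have "length Ls = (\<Sum>s\<leftarrow>[0..<S]. 5)"
    by (simp add: Ls_def length_concat comp_def)
  then have len: "length Ls = 5 * S" by (simp add: sum_list_triv)
  have Ls_cases: "\<exists>s<S. x \<in> set (launches s)" if "x \<in> set Ls" for x
    using that by (auto simp: Ls_def)
  have "cops_win G (length Ls * length C)"
  proof (rule cops_win_of_launches)
    show "set C \<subseteq> ?V" using C by (simp add: well_spread_def)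
    show "1 \<le> d" if "(s, d, T) \<in> set Ls" for s d T
      using Ls_cases[OF that] by (auto simp: launches_def)
    show "reachable_targets C d (T (map r [0..<Suc s]))"
      if "(s, d, T) \<in> set Ls" for s d T and r :: "nat \<Rightarrow> 'a"
    proof -
      have "\<exists>T'. d \<in> {2..4} \<and> T = aim d T'"
        using Ls_cases[OF that] by (auto simp: launches_def)
      then show ?thesis using bad(3) by (auto simp: aim_def)
    qed
  next
    fix r assume r: "robber_play G r"
    show "\<exists>(s, d, T)\<in>set Ls. r (s + d) \<in> nbhd (T (map r [0..<Suc s]))"
    proof (rule ccontr)
      assume "\<not> ?thesis"
      then have no: "r (s + d) \<notin> nbhd (T (map r [0..<Suc s]))"
        if "s < S" "(s, d, T) \<in> set (launches s)" for s d T
        using that by (fastforce simp del: upt_Suc simp: Ls_def)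
      have V: "r t \<in> ?V" for t using robber_play_in_verts[OF r] .
      have step: "r (Suc t) \<in> nbhd A" if "r t \<in> A" for t A using robber_play_nbhd[OF r that] .
      have hist: "map r [0..<Suc s] ! s = r s" for s
        using nth_map_upt[of s "Suc s" 0 r] by simp
      have N1V: "nbhd {r s} \<subseteq> ?V" for s using V nbhd_subset_verts by simp
      have Fj: "F' (2 * j) (map r [0..<Suc (2 * j)]) = Fw j r" for j
        unfolding F'_def using Fw_hist[of j "2 * j" r] by simp
      have aimD: "r (s + d) \<notin> nbhd (A - bad d A)"
        if "s < S" "(s, d, aim d T) \<in> set (launches s)" "T (map r [0..<Suc s]) = A" "A \<subseteq> ?V" for s d T A
      proof -
        have "A \<inter> ?V = A" using that(4) by blast
        then show ?thesis using no[OF that(1,2)] that(3) by (simp del: upt_Suc add: aim_def)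
      qed
      \<comment> \<open>Escaping the first launch puts \<open>r (s + 1)\<close> into
        \<open>?X\<close>, hence \<open>r (s + 3)\<close> into \<open>?Z\<close>; escaping the
        second requires \<open>card ?Z > n / K\<close>. But \<open>card ?Z < K * card ?X\<close>,
        and \<open>?X\<close> lies in \<open>nbhd {r s}\<close>.\<close>
      have degree: "n < card (nbhd {r s}) * K ^ 2" if s: "s < S" for s
      proof -
        let ?X = "bad 2 (nbhd {r s})"
        let ?Z = "ball 2 ?X"
        have XV: "?X \<subseteq> nbhd {r s}" using bad(1)[of 2] N1V by simp
        then have ZV: "?Z \<subseteq> ?V" using N1V by (intro ball_subset_verts) blast
        have "r (s + 2) \<notin> nbhd (nbhd {r s} - ?X)"
          using s N1V by (intro aimD[of s 2 "N1 s"]) (auto simp del: upt_Suc simp: launches_def N1_def hist)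
        then have rX: "r (Suc s) \<in> ?X" using step[of s "{r s}"] step[of "Suc s"] by auto
        then have "r (s + 3) \<in> ?Z"
          using step[OF step[OF rX]] by (simp add: numeral_3_eq_3 numeral_2_eq_2)
        moreover have "r (s + 4) \<notin> nbhd (?Z - bad 4 ?Z)"
          using s ZV by (intro aimD[of s 4 "\<lambda>h. ball 2 (bad 2 (N1 s h))"])
            (auto simp del: upt_Suc simp: launches_def N1_def hist)
        ultimately have "bad 4 ?Z \<noteq> {}" using step[of "s + 3" ?Z] by (auto simp: eval_nat_numeral)
        then have "n < K * card ?Z" using bad4[OF ZV] by linarith
        also have "card ?Z < K * card ?X" using bad(2)[of 2 "nbhd {r s}"] N1V rX by auto
        then have "K * card ?Z \<le> K * (K * card ?X)" by simp
        also have "\<dots> \<le> K * (K * card (nbhd {r s}))"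
          using XV fin[OF N1V] by (simp add: card_mono)
        finally show ?thesis by (simp add: power2_eq_square mult_ac)
      qed
      have stage: "r (2 * j + 3) \<in> Fw (Suc j) r \<and> 2 * card (Fw (Suc j) r) < card (Fw j r)"
        if j: "2 * j + 4 < S" and rF: "r (2 * j + 1) \<in> Fw j r" for j
      proof -
        let ?F = "Fw j r"
        let ?X = "bad 2 ?F"
        let ?P = "pick ?F"
        let ?Q = "bad 3 ?P"
        have F: "?F \<subseteq> ?V" "?F \<noteq> {}" using Fw_V[OF r] rF by auto
        have js: "2 * j < S" using j by simp
        have XF: "?X \<subseteq> ?F" using bad(1)[of 2] F by simp
        then have XV: "?X \<subseteq> ?V" using F by blast
        have PV: "?P \<subseteq> ?V" using pick(1)[OF F] nbhd_subset_verts[OF XV] by blast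
        have QP: "?Q \<subseteq> ?P" using bad(1)[of 3] PV by simp
        then have QV: "?Q \<subseteq> ?V" using PV by blast
        \<comment> \<open>A robber in \<open>?F - ?X\<close> at time \<open>2 * j + 1\<close> would
          be caught one move later.\<close>
        have "r (2 * j + 2) \<notin> nbhd (?F - ?X)"
          using js F(1) by (intro aimD[of "2 * j" 2 "F' (2 * j)"])
            (auto simp del: upt_Suc simp: launches_def Fj)
        then have rX: "r (2 * j + 1) \<in> ?X" using step[of "2 * j + 1"] rF by auto
        then have r2: "r (2 * j + 2) \<in> nbhd ?X" using step[OF rX] by simp
        then have r3: "r (2 * j + 3) \<in> ball 2 ?X"
          using step[OF r2] by (simp add: eval_nat_numeral)
        \<comment> \<open>The centres cover on average \<open>card ?F / 2\<close> vertices of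
          \<open>ball 2 ?X\<close>, which has fewer than \<open>K * card ?F\<close>; hence there are
          at most \<open>2 * K\<close> of them.\<close>
        have "card ?P * card ?F \<le> 2 * card (ball 2 ?X \<inter> nbhd ?P)" using pick(2)[OF F] .
        also have "\<dots> \<le> 2 * card (ball 2 ?X)"
          using fin[OF ball_subset_verts[OF XV]] by (simp add: card_mono)
        also have "\<dots> \<le> 2 * (K * card ?X)" using bad(2)[of 2 ?F] F rX by auto
        also have "\<dots> \<le> 2 * (K * card ?F)" using XF fin[OF F(1)] by (simp add: card_mono)
        finally have P2K: "card ?P \<le> 2 * K" using F fin[OF F(1)] by (simp add: card_gt_0_iff)
        have Q3: "card (ball 3 ?Q) \<le> 2 * K ^ 2"
        proof (cases "?Q = {}")
          case False
          then have "card (ball 3 ?Q) \<le> K * card ?Q" using bad(2)[of 3 ?P] PV by auto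
          also have "\<dots> \<le> K * (2 * K)"
            using card_mono[OF fin[OF PV] QP] P2K by (intro mult_left_mono) auto
          finally show ?thesis by (simp add: power2_eq_square mult_ac)
        qed simp
        \<comment> \<open>Cops on \<open>?P - ?Q\<close> guard their neighbourhood, so the robber
          would be in \<open>nbhd ?Q\<close> and then in \<open>ball 2 ?Q\<close>. Its degree there
          is large, so \<open>dom ?Q\<close> dominates it; this set has at most \<open>n / K\<close>
          vertices and is fully occupied in four moves.\<close>
        have "r (2 * j + 3) \<notin> nbhd ?P"
        proof
          assume "r (2 * j + 3) \<in> nbhd ?P"
          moreover have "r (2 * j + 3) \<notin> nbhd (?P - ?Q)"
            using js PV by (intro aimD[of "2 * j" 3 "\<lambda>h. pick (F' (2 * j) h)"])
              (auto simp del: upt_Suc simp: launches_def Fj)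
          ultimately have "r (2 * j + 3) \<in> nbhd ?Q" by (auto simp: nbhd_def)
          from step[OF this] have "r (2 * j + 4) \<in> ball 2 ?Q" by (simp add: eval_nat_numeral)
          then have "r (2 * j + 4) \<in> nbhd (dom ?Q)"
            using dom(3)[OF QV Q3] degree[OF j] by simp
          moreover have "bad 4 (dom ?Q) = {}"
          proof (rule bad4[OF dom(1)[OF QV Q3]])
            have "K * card (dom ?Q) \<le> K * l" using dom(2)[OF QV Q3] by simp
            then show "K * card (dom ?Q) \<le> n" using lK by (metis mult.commute order_trans)
          qed
          moreover have "r (2 * j + 4) \<notin> nbhd (dom ?Q - bad 4 (dom ?Q))"
            using js dom(1)[OF QV Q3] by (intro aimD[of "2 * j" 4 "\<lambda>h. dom (bad 3 (pick (F' (2 * j) h)))"])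
              (auto simp del: upt_Suc simp: launches_def Fj)
          ultimately show False by simp
        qed
        then have "r (2 * j + 3) \<in> Fw (Suc j) r"
          using r3 step[of "2 * j + 2" "{r (2 * j + 2)}"] by (simp add: Fw_Suc W_def eval_nat_numeral)
        \<comment> \<open>\<open>r (2 * j + 2)\<close> lies in \<open>nbhd ?X\<close>, where the
          choice of \<open>?P\<close> leaves fewer than \<open>card ?F / 2\<close>
          continuations.\<close>
        moreover have "2 * card (Fw (Suc j) r) < card ?F"
          unfolding Fw_Suc W_def using pick(3)[OF F r2] .
        ultimately show ?thesis by blast
      qed
      have "r (2 * j + 1) \<in> Fw j r \<and> 2 ^ j * card (Fw j r) \<le> n" if "j \<le> J" for j
        using that
      proof (induction j)
        case 0
        have "card (nbhd {r 0}) \<le> n" unfolding n(1)[symmetric] using N1V by (intro card_mono) auto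
        then show ?case using step[of 0 "{r 0}"] by (simp add: Fw_0)
      next
        case (Suc j)
        then have IH: "r (2 * j + 1) \<in> Fw j r" "2 ^ j * card (Fw j r) \<le> n" by auto
        have "2 * j + 4 < S" using Suc.prems by (simp add: S_def)
        from stage[OF this IH(1)] have st: "r (2 * j + 3) \<in> Fw (Suc j) r"
          "2 * card (Fw (Suc j) r) \<le> card (Fw j r)" by auto
        have "2 ^ Suc j * card (Fw (Suc j) r) = 2 ^ j * (2 * card (Fw (Suc j) r))" by simp
        also have "\<dots> \<le> 2 ^ j * card (Fw j r)" using st(2) by (intro mult_left_mono) auto
        finally show ?case using st(1) IH(2) by (simp add: eval_nat_numeral)
      qed
      from this[of J] have J1: "r (2 * J + 1) \<in> Fw J r" "2 ^ J * card (Fw J r) \<le> n" by auto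
      then have "card (Fw J r) \<ge> 1"
        using fin[OF Fw_V[OF r]] by (metis One_nat_def Suc_leI card_gt_0_iff empty_iff)
      then have "2 ^ J \<le> 2 ^ J * card (Fw J r)" by simp
      then show False using J1(2) J by linarith
    qed
  qed
  then show ?thesis by (simp add: len S_def)
qed

section \<open>Distances and balls\<close>

lemma awalk_in_ball: "awalk u p v \<Longrightarrow> v \<in> ball (length p) {u}"
proof (induction p arbitrary: u)
  case Nil
  then show ?case by (simp add: awalk_Nil_iff)
next
  case (Cons e es)
  then have e: "e \<in> arcs G" "u = tail G e" and v: "v \<in> ball (length es) {head G e}"
    by (simp_all add: awalk_Cons_iff)
  have "game_step G u (head G e)"
    using in_arcs_imp_in_arcs_ends[OF e(1)] e(2) by (simp add: game_step_def)
  then have "ball (length es) {head G e} \<subseteq> ball (length es) (nbhd {u})"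
    by (intro ball_mono) (auto intro: nbhdI)
  then show ?case using v by (auto simp: funpow_swap1)
qed

lemma ball_mono_radius: "d \<le> d' \<Longrightarrow> ball d A \<subseteq> ball d' A"
  by (rule lift_Suc_mono_le[of "\<lambda>d. ball d A"]) (rule ball_subset_Suc)

lemma verts_subset_ball_of_diameter:
  assumes diam: "graph_diameter G \<le> ereal (real d)" and u: "u \<in> verts G"
  shows "verts G \<subseteq> ball d {u}"
proof
  fix v assume v: "v \<in> verts G"
  have "\<mu> (\<lambda>_. 1) u v \<le> graph_diameter G"
    unfolding graph_diameter_def using u v by (intro SUP_upper2[of u] SUP_upper2[of v]) auto
  \<comment> \<open>Lengths are integers, so a walk of cost below \<open>d + 1\<close> suffices and
    none attaining the infimum has to be produced.\<close>
  also have "\<dots> < ereal (real d + 1)" using diam by (simp add: le_less_trans)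
  finally obtain p where p: "awalk u p v" "awalk_cost (\<lambda>_. 1) p < real d + 1"
    unfolding \<mu>_def INF_less_iff by auto
  have "awalk_cost (\<lambda>_. 1) p = real (length p)" by (induction p) auto
  then have "length p \<le> d" using p(2) by simp
  then show "v \<in> ball d {u}" using awalk_in_ball[OF p(1)] ball_mono_radius by blast
qed

end

section \<open>Choice of the parameters and asymptotics\<close>

lemma cop_number_le: "cops_win G k \<Longrightarrow> cop_number G \<le> k"
  unfolding cop_number_def by (rule Least_le)

text \<open>
  The size of \<open>K\<close>: it has to satisfy \<open>4 K\<^sup>5 ln n \<le> n\<^sup>2\<close>, so that a dominating set of the size given by
  \<open>ex_dominating_subset\<close> has at most \<open>n / K\<close> elements.
\<close>

definition expansion_bound :: "real \<Rightarrow> real" where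
  "expansion_bound n = (n\<^sup>2 / (4 * ln n)) powr (1 / 5)"

text \<open>Five launches at each of \<open>2 * J + 3\<close> times, with
  \<open>J \<le> log 2 n + 1\<close>, times the length of \<open>C\<close>. Rounding
  \<open>expansion_bound n\<close> down to \<open>K\<close> turns a factor 2 into 4.\<close>

definition cop_bound :: "real \<Rightarrow> real" where
  "cop_bound n = 5 * (2 * (log 2 n + 1) + 3) * (4 * n * ln (16 * n) / expansion_bound n + 1)"

lemma cop_number_le_cop_bound:
  fixes G :: "('a, 'b) pre_digraph"
  assumes G: "graph G" and n: "card (verts G) = n" "2 \<le> n" and diam: "graph_diameter G \<le> 4"
    and x: "2 \<le> expansion_bound n" "expansion_bound n \<le> n / 4"
  shows "real (cop_number G) \<le> cop_bound n"
proof -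
  interpret graph G by (rule G)
  define x where "x = expansion_bound (real n)"
  have ln0: "0 < ln (real n)" and n0: "0 < real n" using n by simp_all
  define K where "K = nat \<lfloor>x\<rfloor>"
  have Kx: "real K \<le> x" "x / 2 \<le> real K" "0 < K"
    using assms(5) unfolding K_def x_def[symmetric] by linarith+
  have "real K ^ 5 \<le> x ^ 5" using Kx(1) by (intro power_mono) auto
  also have "x ^ 5 = (real n)\<^sup>2 / (4 * ln n)"
    using n0 ln0 unfolding x_def expansion_bound_def by (simp add: powr_power)
  finally have K5: "real K ^ 5 \<le> (real n)\<^sup>2 / (4 * ln n)" .
  \<comment> \<open>The domination condition needs \<open>l\<close> above
    \<open>2 * K ^ 4 * ln n / n\<close>. In \<open>l * K\<close> this main term and the rounding
    error, at most 2, contribute at most \<open>n / 2\<close> each.\<close>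
  define l where "l = nat \<lceil>2 * real K ^ 4 * ln n / n\<rceil> + 1"
  have "0 \<le> 2 * real K ^ 4 * ln n / n" using ln0 by simp
  then have l: "2 * real K ^ 4 * ln n / n < real l" "real l \<le> 2 * real K ^ 4 * ln n / n + 2"
    unfolding l_def by linarith+
  have "real l * real K \<le> (2 * real K ^ 4 * ln n / n + 2) * real K"
    using l(2) by (intro mult_right_mono) auto
  also have "\<dots> = 2 * ln n / n * real K ^ 5 + 2 * real K" by (simp add: field_simps eval_nat_numeral)
  also have "\<dots> \<le> 2 * ln n / n * ((real n)\<^sup>2 / (4 * ln n)) + 2 * (n / 4)"
    using K5 ln0 Kx(1) assms(6) unfolding x_def by (intro add_mono mult_left_mono) auto
  also have "\<dots> = n" using ln0 n0 by (simp add: field_simps power2_eq_square)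
  finally have lK: "l * K \<le> n" by (metis of_nat_le_iff of_nat_mult)
  have "ln n < real l * real n / (2 * real K ^ 4)"
    using l(1) n0 Kx(3) by (simp add: field_simps)
  then have "exp (- (real l * real n / (2 * real K ^ 4))) < exp (- ln n)" by simp
  also have "\<dots> = 1 / n" using n0 by (simp add: exp_minus inverse_eq_divide)
  finally have lexp: "real n * exp (- (real l * real n / (2 * real K ^ 4))) < 1"
    using n0 by (simp add: field_simps)
  define m where "m = nat \<lceil>2 * n * ln (16 * n) / K\<rceil>"
  have "0 \<le> 2 * n * ln (16 * n) / K" using n by simp
  then have m: "2 * n * ln (16 * n) / K \<le> real m" "real m \<le> 2 * n * ln (16 * n) / K + 1"
    unfolding m_def by linarith+
  have "ln (16 * n) \<le> real m * real K / (2 * real n)"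
    using m(1) n0 Kx(3) by (simp add: field_simps)
  then have "exp (- (real m * real K / (2 * real n))) \<le> exp (- ln (16 * n))" by simp
  also have "\<dots> = 1 / (16 * real n)" using n0 by (simp add: exp_minus inverse_eq_divide)
  finally have mexp: "exp (- (real m * real K / (2 * real n))) \<le> 1 / (16 * real n)" .
  define J where "J = nat \<lfloor>log 2 n\<rfloor> + 1"
  have "0 \<le> log 2 n" using n by simp
  then have J: "log 2 n < real J" "real J \<le> log 2 n + 1" unfolding J_def by linarith+
  have "real n < 2 powr real J" using J(1) n0 by (simp add: log_less_iff)
  then have nJ: "n < 2 ^ J" by (simp add: powr_realpow flip: of_nat_less_iff)
  obtain C where C: "length C = m" "well_spread K C"
    using ex_well_spread[OF n(1) _ mexp] n(2) by auto
  have "cops_win G (5 * (2 * J + 3) * length C)"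
  proof (rule cops_win_of_well_spread[OF C(2) n(1) _ Kx(3) _ lK lexp nJ])
    show "0 < n" using n(2) by simp
    show "verts G \<subseteq> ball 4 {u}" if "u \<in> verts G" for u
      using verts_subset_ball_of_diameter[of 4 u] diam that by simp
  qed
  then have "real (cop_number G) \<le> real (5 * (2 * J + 3) * m)"
    using cop_number_le C(1) of_nat_mono by blast
  also have "\<dots> = 5 * (2 * real J + 3) * real m" by simp
  also have "\<dots> \<le> 5 * (2 * (log 2 n + 1) + 3) * (4 * n * ln (16 * n) / x + 1)"
  proof (intro mult_mono)
    have "2 * n * ln (16 * n) / K \<le> 2 * n * ln (16 * n) / (x / 2)"
      using Kx assms(5) n by (intro divide_left_mono) (auto simp: x_def)
    then show "real m \<le> 4 * n * ln (16 * n) / x + 1" using m(2) by simp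
  qed (use J n in auto)
  finally show ?thesis by (simp add: cop_bound_def x_def)
qed

theorem theorem6:
  shows "\<exists>\<epsilon> :: nat \<Rightarrow> real. \<epsilon> \<longlonglongrightarrow> 0 \<and>
    (\<forall>(G :: ('a, 'b) pre_digraph) n.
       graph G \<and> card (verts G) = n \<and> 2 \<le> n \<and> graph_diameter G \<le> 4 \<longrightarrow>
       real (cop_number G) < real n powr (3 / 5 + \<epsilon> n))"
proof -
  have "\<forall>\<^sub>F n :: nat in sequentially. 2 \<le> expansion_bound n \<and> expansion_bound n \<le> n / 4"
    unfolding expansion_bound_def by (intro eventually_conj; real_asymp)
  then obtain N :: nat where N: "\<And>n. N \<le> n \<Longrightarrow> 2 \<le> expansion_bound n \<and> expansion_bound n \<le> n / 4"
    unfolding eventually_sequentially by blast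
  \<comment> \<open>Solves \<open>n powr (3 / 5 + \<delta> n) = cop_bound n + 1\<close>, where the
    extra 1 gives strictness. It tends to 0 because \<open>cop_bound n\<close> is
    \<open>n powr (3 / 5)\<close> up to powers of logarithms.\<close>
  define \<delta> where "\<delta> n = ln (cop_bound (real n) + 1) / ln n - 3 / 5" for n :: nat
  \<comment> \<open>For \<open>n < N\<close> the value 1 lifts the exponent above 1, and the trivial
    bound by \<open>n\<close> cops suffices.\<close>
  define \<epsilon> where "\<epsilon> n = (if N \<le> n then \<delta> n else 1)" for n
  have "\<delta> \<longlonglongrightarrow> 0"
    unfolding \<delta>_def cop_bound_def expansion_bound_def by real_asymp
  moreover have "\<forall>\<^sub>F n in sequentially. \<delta> n = \<epsilon> n"
    unfolding \<epsilon>_def eventually_sequentially by auto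
  ultimately have "\<epsilon> \<longlonglongrightarrow> 0" by (rule Lim_transform_eventually)
  moreover have "real (cop_number G) < real n powr (3 / 5 + \<epsilon> n)"
    if G: "graph G" "card (verts G) = n" "2 \<le> n" "graph_diameter G \<le> 4"
    for G :: "('a, 'b) pre_digraph" and n
  proof (cases "N \<le> n")
    case True
    have le: "real (cop_number G) \<le> cop_bound n"
      using cop_number_le_cop_bound[OF G] N[OF True] by simp
    then have "0 < cop_bound n + 1" by linarith
    then have "real n powr (3 / 5 + \<epsilon> n) = cop_bound n + 1"
      using G(3) True by (simp add: \<epsilon>_def \<delta>_def powr_def)
    then show ?thesis using le by simp
  next
    case False
    have "finite (verts G)" using G(2,3) by (intro card_ge_0_finite) simp
    then have "real (cop_number G) \<le> real n powr 1"
      using cop_number_le[OF cops_win_card_verts, of G] G(2,3) by simp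
    also have "\<dots> < real n powr (3 / 5 + \<epsilon> n)"
      using G(3) False by (intro powr_less_mono) (auto simp: \<epsilon>_def)
    finally show ?thesis .
  qed
  ultimately show ?thesis by blast
qed

end
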